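(* Let $X$ be a smooth manifold (without boundary), $Y$ a compact Polish space, $\mu\in\mathcal{P}(X)$, $\nu\in\mathcal{P}(Y)$, and let $c\colon X\times Y\to\mathbb{R}_+$ be continuous such that $c(\cdot,y)$ is differentiable and locally Lipschitz uniformly in $y\in Y$, with $T_c(\mu,\nu)<\infty$. If $M=\mathrm{int}(\mathrm{supp}\,\mu)$ is connected and $\mathrm{cl}(M)=\mathrm{supp}\,\mu$, then the Kantorovich potentials $S_c(\mu,\nu)$ are (almost surely) unique.
   Context: $X$ is also Polish as a topological space. $\mathcal{P}(X)$ is the set of Borel probability measures; $\mathcal{C}(\mu,\nu)$ is the set of probability measures on $X\times Y$ with marginals $\mu,\nu$; $T_c(\mu,\nu)=\inf_{\pi\in\mathcal{C}(\mu,\nu)}\int c\,\mathrm{d}\pi$, and $\pi$ is optimal if it attains the infimum. $\mathrm{supp}$ is the smallest closed set of full measure; $\mathrm{int}$ and $\mathrm{cl}$ denote interior and closure in $X$. Kantorovich potentials: for $g\colon Y\to\mathbb{R}\cup\{-\infty\}$ set $g^c(x)=\inf_{y\in Y}c(x,y)-g(y)$, and for $f\colon X\to\mathbb{R}\cup\{-\infty\}$ set $f^c(y)=\inf_{x\in X}c(x,y)-f(x)$. A function $f\colon X\to\mathbb{R}\cup\{-\infty\}$ is $c$-concave on $X$ if $f=g^c$ for some $g\colon Y\to\mathbb{R}\cup\{-\infty\}$ and $f\not\equiv-\infty$. $S_c(\mu,\nu)$ is the set of $c$-concave $f$ with $T_c(\mu,\nu)=\int c\,\mathrm{d}\pi=\int(f(x)+f^c(y))\,\mathrm{d}\pi(x,y)$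 for an optimal plan $\pi$ (equivalently, every optimal plan). They are called unique if $f_1-f_2$ is $\mu$-almost surely constant for all $f_1,f_2\in S_c(\mu,\nu)$. A function on a smooth manifold is locally Lipschitz if it is locally Lipschitz in every chart of an atlas. A family $(f_y)_{y\in Y}$ is locally Lipschitz uniformly in $y$ if each $f_y$ is locally Lipschitz with neighborhoods and Lipschitz constants that do not depend on $y$. *)

theory Defs
  imports "HOL-Probability.Probability"
begin

section \<open>Smooth manifolds\<close>

text \<open>\<open>k\<close> times continuous differentiability on an open subset of a finite-dimensional normed space,
  by iterating directional derivatives of the Frechet derivative.\<close>

primrec Ck_on :: "nat \<Rightarrow> ('a::real_normed_vector \<Rightarrow> 'b::real_normed_vector) \<Rightarrow> 'a set \<Rightarrow> bool" where
  "Ck_on 0 f S \<longleftrightarrow> continuous_on S f"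
| "Ck_on (Suc k) f S \<longleftrightarrow>
     (\<forall>x\<in>S. f differentiable (at x)) \<and> (\<forall>v. Ck_on k (\<lambda>x. frechet_derivative f (at x) v) S)"

definition smooth_on :: "('a::real_normed_vector \<Rightarrow> 'b::real_normed_vector) \<Rightarrow> 'a set \<Rightarrow> bool" where
  "smooth_on f S \<longleftrightarrow> (\<forall>k. Ck_on k f S)"

text \<open>A chart is a pair of a domain and a coordinate map; the map is only relevant on the domain.\<close>

type_synonym ('x, 'e) chart = "'x set \<times> ('x \<Rightarrow> 'e)"

definition is_chart :: "('x::topological_space, 'e::real_normed_vector) chart \<Rightarrow> bool" where
  "is_chart = (\<lambda>(U, \<phi>). open U \<and> open (\<phi> ` U) \<and> (\<exists>\<psi>. homeomorphism U (\<phi> ` U) \<phi> \<psi>))"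

definition smooth_transition ::
  "('x::topological_space, 'e::real_normed_vector) chart \<Rightarrow> ('x, 'e) chart \<Rightarrow> bool" where
  "smooth_transition =
     (\<lambda>(U, \<phi>) (V, \<psi>). smooth_on (\<lambda>p. \<psi> (the_inv_into U \<phi> p)) (\<phi> ` (U \<inter> V)))"

text \<open>The type \<open>'e\<close> plays the role of \<open>\<real>\<^sup>n\<close>. It is taken to be a finite-dimensional
  normed space, rather than of class \<open>euclidean_space\<close>, so that manifolds of dimension 0 are
  included. The Hausdorff property and second countability of the manifold
  are not part of this definition; they come from the type class of \<open>'x\<close>.\<close>

definition smooth_atlas :: "('x::topological_space, 'e::real_normed_vector) chart set \<Rightarrow> bool" where
  "smooth_atlas A \<longleftrightarrow>
     (\<exists>B::'e set. finite B \<and> span B = UNIV) \<and>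
     (\<forall>C\<in>A. is_chart C) \<and>
     (\<Union>C\<in>A. fst C) = UNIV \<and>
     (\<forall>C\<in>A. \<forall>D\<in>A. smooth_transition C D)"

definition manifold_differentiable ::
  "('x::topological_space, 'e::real_normed_vector) chart set \<Rightarrow> ('x \<Rightarrow> real) \<Rightarrow> bool" where
  "manifold_differentiable A f \<longleftrightarrow>
     (\<forall>(U, \<phi>)\<in>A. \<forall>p\<in>\<phi> ` U. (\<lambda>q. f (the_inv_into U \<phi> q)) differentiable (at p))"

definition locally_Lipschitz_uniformly ::
  "('x::topological_space, 'e::real_normed_vector) chart set \<Rightarrow> ('y \<Rightarrow> 'x \<Rightarrow> real) \<Rightarrow> bool" where
  "locally_Lipschitz_uniformly A f \<longleftrightarrow>
     (\<forall>(U, \<phi>)\<in>A. \<forall>p\<in>\<phi> ` U. \<exists>W L. open W \<and> p \<in> W \<and> W \<subseteq> \<phi> ` U \<and>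
        (\<forall>y. L-lipschitz_on W (\<lambda>q. f y (the_inv_into U \<phi> q))))"


section \<open>Optimal transport\<close>

definition borel_probs :: "'a::topological_space measure set" where
  "borel_probs = {M. prob_space M \<and> sets M = sets borel}"

definition supp :: "'a::topological_space measure \<Rightarrow> 'a set" where
  "supp M = \<Inter>{C. closed C \<and> emeasure M (- C) = 0}"

definition couplings :: "'x::topological_space measure \<Rightarrow> 'y::topological_space measure
    \<Rightarrow> ('x \<times> 'y) measure set" where
  "couplings \<mu> \<nu> = {\<pi>\<in>borel_probs. distr \<pi> borel fst = \<mu> \<and> distr \<pi> borel snd = \<nu>}"

definition plan_cost :: "('x \<Rightarrow> 'y \<Rightarrow> real) \<Rightarrow> ('x \<times> 'y) measure \<Rightarrow> ennreal" where
  "plan_cost c \<pi> = (\<integral>\<^sup>+(x, y). ennreal (c x y) \<partial>\<pi>)"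

definition transport_cost :: "('x::topological_space \<Rightarrow> 'y::topological_space \<Rightarrow> real)
    \<Rightarrow> 'x measure \<Rightarrow> 'y measure \<Rightarrow> ennreal" where
  "transport_cost c \<mu> \<nu> = (INF \<pi>\<in>couplings \<mu> \<nu>. plan_cost c \<pi>)"

definition optimal_plans :: "('x::topological_space \<Rightarrow> 'y::topological_space \<Rightarrow> real)
    \<Rightarrow> 'x measure \<Rightarrow> 'y measure \<Rightarrow> ('x \<times> 'y) measure set" where
  "optimal_plans c \<mu> \<nu> = {\<pi>\<in>couplings \<mu> \<nu>. plan_cost c \<pi> = transport_cost c \<mu> \<nu>}"

text \<open>Functions with values in \<open>\<real> \<union> {-\<infinity>}\<close> are \<open>ereal\<close>-valued functions
  that avoid \<open>\<infinity>\<close>.\<close>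

definition c_transform_Y :: "('x \<Rightarrow> 'y \<Rightarrow> real) \<Rightarrow> ('y \<Rightarrow> ereal) \<Rightarrow> 'x \<Rightarrow> ereal" where
  "c_transform_Y c g x = (INF y. ereal (c x y) - g y)"

definition c_transform_X :: "('x \<Rightarrow> 'y \<Rightarrow> real) \<Rightarrow> ('x \<Rightarrow> ereal) \<Rightarrow> 'y \<Rightarrow> ereal" where
  "c_transform_X c f y = (INF x. ereal (c x y) - f x)"

definition c_concave :: "('x \<Rightarrow> 'y \<Rightarrow> real) \<Rightarrow> ('x \<Rightarrow> ereal) \<Rightarrow> bool" where
  "c_concave c f \<longleftrightarrow>
     (\<forall>x. f x \<noteq> \<infinity>) \<and> (\<exists>x. f x \<noteq> -\<infinity>) \<and>
     (\<exists>g. (\<forall>y. g y \<noteq> \<infinity>) \<and> f = c_transform_Y c g)"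

text \<open>Integral of an extended real-valued function as positive part minus negative part. Below, the
  integrand \<open>f x + f\<^sup>c y\<close> is at most \<open>c x y\<close>, so for a plan of finite cost the positive part has
  a finite integral and the difference is never \<open>\<infinity> - \<infinity>\<close>.\<close>

definition ereal_integral :: "'a measure \<Rightarrow> ('a \<Rightarrow> ereal) \<Rightarrow> ereal" where
  "ereal_integral M h =
     enn2ereal (\<integral>\<^sup>+z. e2ennreal (h z) \<partial>M) - enn2ereal (\<integral>\<^sup>+z. e2ennreal (- h z) \<partial>M)"

definition Kantorovich_potentials :: "('x::topological_space \<Rightarrow> 'y::topological_space \<Rightarrow> real)
    \<Rightarrow> 'x measure \<Rightarrow> 'y measure \<Rightarrow> ('x \<Rightarrow> ereal) set" where
  "Kantorovich_potentials c \<mu> \<nu> =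
     {f. c_concave c f \<and>
         (\<exists>\<pi>\<in>optimal_plans c \<mu> \<nu>.
            enn2ereal (transport_cost c \<mu> \<nu>) =
              ereal_integral \<pi> (\<lambda>(x, y). f x + c_transform_X c f y))}"

text \<open>In \<open>ereal\<close>, the equation \<open>f\<^sub>1 x - f\<^sub>2 x = ereal a\<close> can only hold when both
  values are finite.\<close>

definition unique_Kantorovich_potentials ::
  "('x::topological_space \<Rightarrow> 'y::topological_space \<Rightarrow> real) \<Rightarrow> 'x measure \<Rightarrow> 'y measure \<Rightarrow> bool" where
  "unique_Kantorovich_potentials c \<mu> \<nu> \<longleftrightarrow>
     (\<forall>f\<^sub>1\<in>Kantorovich_potentials c \<mu> \<nu>. \<forall>f\<^sub>2\<in>Kantorovich_potentials c \<mu> \<nu>.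
        \<exists>a::real. AE x in \<mu>. f\<^sub>1 x - f\<^sub>2 x = ereal a)"

end

theory Submission
  imports Defs
begin

text \<open>Since \<open>Y\<close> is compact and \<open>c\<close> is nonnegative, potentials are real-valued, and they inherit local Lipschitz
  continuity from \<open>c\<close>. For a fixed optimal plan, the pairs at which two given potentials
  \<open>f\<^sub>1\<close>, \<open>f\<^sub>2\<close> are both in contact with \<open>c\<close> form a closed set of full measure, and compactness
  of \<open>Y\<close> makes its projection to \<open>X\<close> closed; so every \<open>x\<close> in the support has a \<open>y\<close> such that
  \<open>c(\<cdot>, y) - f\<^sub>i\<close> is minimal at \<open>x\<close> for \<open>i = 1, 2\<close>. Along a segment in a chart, \<open>f\<^sub>1\<close> and \<open>f\<^sub>2\<close> thus
  have a common superderivative at every point. Right difference quotients of \<open>f\<^sub>1\<close> are then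
  asymptotically below, and left difference quotients of \<open>f\<^sub>2\<close> asymptotically above, the same number.
  Integrating over the segment gives \<open>f\<^sub>1(b) - f\<^sub>1(a) \<le> f\<^sub>2(b) - f\<^sub>2(a)\<close> without Rademacher's theorem, and
  by symmetry \<open>f\<^sub>1 - f\<^sub>2\<close> is locally constant on the interior of the support.\<close>

section \<open>Functions on an interval with common superderivatives\<close>

lemma DERIV_sequentially_quotient:
  fixes F :: "real \<Rightarrow> real"
  assumes "(F has_real_derivative D) (at x)" and "e \<longlonglongrightarrow> 0" and "\<And>n. e n \<noteq> 0"
  shows "(\<lambda>n. (F (x + e n) - F x) / e n) \<longlonglongrightarrow> D"
proof -
  have "filterlim e (at 0) sequentially"
    using assms(2,3) by (simp add: filterlim_at)
  from filterlim_compose[OF _ this, of "\<lambda>h. (F (x + h) - F x) / h"] assms(1)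
  show ?thesis by (simp add: DERIV_def)
qed

text \<open>The witness \<open>k\<close> may vary arbitrarily with \<open>t\<close>: it only bounds
  difference quotients at \<open>t\<close>, and these bounds are integrated over \<open>t\<close>.
  The margin \<open>\<eta>\<close> leaves room for evaluating \<open>f\<^sub>1\<close> and
  \<open>f\<^sub>2\<close> slightly outside \<open>{a..b}\<close>.\<close>

lemma common_superderivative_increment_le:
  fixes f\<^sub>1 f\<^sub>2 :: "real \<Rightarrow> real"
  assumes "a \<le> b" "0 < \<eta>"
    and lip1: "L-lipschitz_on {a - \<eta>..b + \<eta>} f\<^sub>1"
    and lip2: "L-lipschitz_on {a - \<eta>..b + \<eta>} f\<^sub>2"
    and super: "\<And>t. t \<in> {a..b} \<Longrightarrow> \<exists>k D. (k has_real_derivative D) (at t) \<and>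
      (\<forall>s\<in>{a - \<eta>..b + \<eta>}. f\<^sub>1 s - f\<^sub>1 t \<le> k s - k t \<and> f\<^sub>2 s - f\<^sub>2 t \<le> k s - k t)"
  shows "f\<^sub>1 b - f\<^sub>1 a \<le> f\<^sub>2 b - f\<^sub>2 a"
proof -
  define I where "I = {a - \<eta>..b + \<eta>}"
  define e :: "nat \<Rightarrow> real" where "e n = \<eta> / (Suc n)" for n
  have e0: "e \<longlonglongrightarrow> 0"
    using tendsto_mult[OF tendsto_const[of \<eta>] LIMSEQ_inverse_real_of_nat] by (simp add: e_def[abs_def] divide_inverse)
  have epos: "0 < e n" "e n \<le> \<eta>" for n
    using \<open>0 < \<eta>\<close> by (auto simp: e_def field_simps)
  have en0: "e n \<noteq> 0" for n
    using epos[of n] by simp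
  have me0: "(\<lambda>n. - e n) \<longlonglongrightarrow> 0"
    using tendsto_minus[OF e0] by simp
  have cont: "continuous_on I f\<^sub>1" "continuous_on I f\<^sub>2"
    using lip1 lip2 by (auto simp: I_def lipschitz_on_continuous_on)
  \<comment> \<open>Antiderivatives express the integrals of shifted copies of
    \<open>f\<^sub>1\<close> and \<open>f\<^sub>2\<close>; the margin makes their derivatives
    two-sided on \<open>{a..b}\<close>.\<close>
  obtain F\<^sub>1 F\<^sub>2 where
    F: "\<And>x. x \<in> I \<Longrightarrow> (F\<^sub>1 has_vector_derivative f\<^sub>1 x) (at x within I)"
       "\<And>x. x \<in> I \<Longrightarrow> (F\<^sub>2 has_vector_derivative f\<^sub>2 x) (at x within I)"
    using antiderivative_continuous cont unfolding I_def by metis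
  have F': "(F\<^sub>1 has_real_derivative f\<^sub>1 x) (at x)" "(F\<^sub>2 has_real_derivative f\<^sub>2 x) (at x)"
    if "x \<in> {a..b}" for x
  proof -
    have "x \<in> interior I" "x \<in> I"
      using that \<open>0 < \<eta>\<close> by (auto simp: I_def)
    then show "(F\<^sub>1 has_real_derivative f\<^sub>1 x) (at x)" "(F\<^sub>2 has_real_derivative f\<^sub>2 x) (at x)"
      using F[of x] unfolding has_real_derivative_iff_has_vector_derivative
      by (metis at_within_interior)+
  qed
  \<comment> \<open>\<open>w n t\<close> is the right difference quotient of
    \<open>f\<^sub>1\<close> at \<open>t\<close> minus the left one of \<open>f\<^sub>2\<close>. Its
    integral \<open>J n\<close> telescopes to difference quotients of the antiderivatives at
    \<open>a\<close> and \<open>b\<close>, and these converge to the values of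
    \<open>f\<^sub>1\<close> and \<open>f\<^sub>2\<close> there. The form \<open>+ - e n\<close>
    fits the quotient lemma for the null sequence \<open>- e n\<close>.\<close>
  define w where "w n t = ((f\<^sub>1 (t + e n) - f\<^sub>1 t) - (f\<^sub>2 t - f\<^sub>2 (t - e n))) / e n" for n t
  define J where "J n = (((F\<^sub>1 (b + e n) - F\<^sub>1 b) / e n - (F\<^sub>1 (a + e n) - F\<^sub>1 a) / e n)
      - ((F\<^sub>2 (b + - e n) - F\<^sub>2 b) / (- e n) - (F\<^sub>2 (a + - e n) - F\<^sub>2 a) / (- e n)))" for n
  have shift: "((\<lambda>t. g (t + h)) has_integral (G (b + h) - G (a + h))) {a..b}"
    if G: "\<And>x. x \<in> I \<Longrightarrow> (G has_vector_derivative g x) (at x within I)" and h: "\<bar>h\<bar> \<le> \<eta>"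
    for g G :: "real \<Rightarrow> real" and h
  proof (rule fundamental_theorem_of_calculus[OF \<open>a \<le> b\<close>])
    fix x assume x: "x \<in> {a..b}"
    have "x + h \<in> I" and sub: "(\<lambda>t. t + h) ` {a..b} \<subseteq> I"
      using x h by (auto simp: I_def)
    then have "(G has_vector_derivative g (x + h)) (at (x + h) within (\<lambda>t. t + h) ` {a..b})"
      using G has_vector_derivative_within_subset by blast
    then have "((G \<circ> (\<lambda>t. t + h)) has_vector_derivative 1 *\<^sub>R g (x + h)) (at x within {a..b})"
      by (intro vector_diff_chain_within) (auto intro!: derivative_eq_intros)
    then show "((\<lambda>t. G (t + h)) has_vector_derivative g (x + h)) (at x within {a..b})"
      by (simp add: o_def)
  qed
  have wint: "(w n has_integral J n) {a..b}" for n
  proof -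
    \<comment> \<open>The zero shift covers the unshifted summands.\<close>
    have h: "\<bar>e n\<bar> \<le> \<eta>" "\<bar>- e n\<bar> \<le> \<eta>" "\<bar>0\<bar> \<le> \<eta>"
      using epos[of n] by auto
    have "((\<lambda>t. ((f\<^sub>1 (t + e n) - f\<^sub>1 (t + 0)) - (f\<^sub>2 (t + 0) - f\<^sub>2 (t + - e n))) / e n) has_integral
      ((((F\<^sub>1 (b + e n) - F\<^sub>1 (a + e n)) - (F\<^sub>1 (b + 0) - F\<^sub>1 (a + 0)))
      - ((F\<^sub>2 (b + 0) - F\<^sub>2 (a + 0)) - (F\<^sub>2 (b + - e n) - F\<^sub>2 (a + - e n)))) / e n)) {a..b}"
      by (intro has_integral_divide has_integral_diff shift F h)
    moreover have "(((F\<^sub>1 (b + e n) - F\<^sub>1 (a + e n)) - (F\<^sub>1 (b + 0) - F\<^sub>1 (a + 0)))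
      - ((F\<^sub>2 (b + 0) - F\<^sub>2 (a + 0)) - (F\<^sub>2 (b + - e n) - F\<^sub>2 (a + - e n)))) / e n = J n"
      using en0[of n] by (simp add: J_def field_simps)
    ultimately show ?thesis
      by (simp add: w_def[abs_def])
  qed
  have Jlim: "J \<longlonglongrightarrow> (f\<^sub>1 b - f\<^sub>1 a) - (f\<^sub>2 b - f\<^sub>2 a)"
    unfolding J_def using \<open>a \<le> b\<close> en0
    by (intro tendsto_diff DERIV_sequentially_quotient[OF _ e0] DERIV_sequentially_quotient[OF _ me0] F')
      auto
  have wcont: "continuous_on {a..b} (w n)" for n
  proof -
    have "continuous_on {a..b} (\<lambda>t. f\<^sub>1 (t + e n))" "continuous_on {a..b} f\<^sub>1"
      "continuous_on {a..b} (\<lambda>t. f\<^sub>2 (t - e n))" "continuous_on {a..b} f\<^sub>2"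
      using epos[of n] by (auto intro!: continuous_intros continuous_on_compose2[OF cont(1)]
          continuous_on_compose2[OF cont(2)] simp: I_def)
    then show ?thesis
      unfolding w_def using en0 by (intro continuous_intros) auto
  qed
  have wbound: "\<bar>w n t\<bar> \<le> 2 * L" if "t \<in> {a..b}" for n t
  proof -
    have I: "t \<in> I" "t + e n \<in> I" "t - e n \<in> I"
      using that epos[of n] by (auto simp: I_def)
    have "\<bar>f\<^sub>1 (t + e n) - f\<^sub>1 t\<bar> \<le> L * e n" "\<bar>f\<^sub>2 t - f\<^sub>2 (t - e n)\<bar> \<le> L * e n"
      using lipschitz_onD[OF lip1, of "t + e n" t] lipschitz_onD[OF lip2, of t "t - e n"] I epos[of n]
      by (auto simp: dist_real_def I_def)
    then have "\<bar>(f\<^sub>1 (t + e n) - f\<^sub>1 t) - (f\<^sub>2 t - f\<^sub>2 (t - e n))\<bar> \<le> 2 * L * e n"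
      by linarith
    then show ?thesis
      using epos(1)[of n] by (simp add: w_def field_simps)
  qed
  \<comment> \<open>Only an upper bound is available: \<open>w n t\<close> is at most the right
    minus the left difference quotient of \<open>k\<close>, which tends to \<open>D - D\<close>.
    Hence the positive part, whose integral still dominates \<open>J n\<close>.\<close>
  have wlim: "(\<lambda>n. max 0 (w n t)) \<longlonglongrightarrow> 0" if t: "t \<in> {a..b}" for t
  proof -
    obtain k D where k: "(k has_real_derivative D) (at t)"
      and le: "\<And>s. s \<in> I \<Longrightarrow> f\<^sub>1 s - f\<^sub>1 t \<le> k s - k t" "\<And>s. s \<in> I \<Longrightarrow> f\<^sub>2 s - f\<^sub>2 t \<le> k s - k t"
      using super[OF t] unfolding I_def by blast
    define v where "v n = (k (t + e n) - k t) / e n - (k (t + - e n) - k t) / (- e n)" for n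
    have "v \<longlonglongrightarrow> D - D"
      unfolding v_def using en0
      by (intro tendsto_diff DERIV_sequentially_quotient[OF k] e0 me0) auto
    then have vlim: "(\<lambda>n. max 0 (v n)) \<longlonglongrightarrow> 0"
      using tendsto_max[OF tendsto_const[of 0], of v 0] by simp
    have "w n t \<le> v n" for n
    proof -
      have "t + e n \<in> I" "t - e n \<in> I"
        using t epos[of n] by (auto simp: I_def)
      then have "(f\<^sub>1 (t + e n) - f\<^sub>1 t) - (f\<^sub>2 t - f\<^sub>2 (t - e n)) \<le> (k (t + e n) - k t) + (k (t - e n) - k t)"
        using le by fastforce
      moreover have "v n = ((k (t + e n) - k t) + (k (t - e n) - k t)) / e n"
        using en0[of n] by (simp add: v_def field_simps)
      ultimately show ?thesis
        using epos(1)[of n] by (simp add: w_def divide_right_mono)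
    qed
    then show ?thesis
      by (intro tendsto_sandwich[OF _ _ tendsto_const vlim] always_eventually allI) (auto simp: max_def intro: order_trans)
  qed
  have "(\<lambda>n. integral {a..b} (\<lambda>t. max 0 (w n t))) \<longlonglongrightarrow> integral {a..b} (\<lambda>t. 0)"
  proof (rule dominated_convergence(2))
    show "(\<lambda>t. max 0 (w n t)) integrable_on {a..b}" for n
      by (intro integrable_continuous_real continuous_intros wcont)
    show "norm (max 0 (w n t)) \<le> 2 * L" if "t \<in> {a..b}" for n t
      using wbound[OF that, of n] by auto
  qed (use wlim in auto)
  moreover have "J n \<le> integral {a..b} (\<lambda>t. max 0 (w n t))" for n
    using wint by (rule has_integral_le) 
      (auto intro!: integrable_integral integrable_continuous_real continuous_intros wcont)
  ultimately have "(f\<^sub>1 b - f\<^sub>1 a) - (f\<^sub>2 b - f\<^sub>2 a) \<le> 0"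
    by (intro LIMSEQ_le[OF Jlim]) auto
  then show ?thesis by simp
qed

section \<open>Supports of measures and projection along a compact factor\<close>

text \<open>The complement is a union of open null sets, and by Lindelof countably many of them
  suffice.\<close>

lemma emeasure_compl_supp:
  fixes M :: "'a::second_countable_topology measure"
  assumes "sets M = sets borel"
  shows "emeasure M (- supp M) = 0"
proof -
  define F where "F = {U. open U \<and> emeasure M U = 0}"
  have "- supp M = \<Union>F"
  proof (intro equalityI subsetI)
    fix x assume "x \<in> - supp M"
    then obtain C where "closed C" "emeasure M (- C) = 0" "x \<notin> C"
      by (auto simp: supp_def)
    then show "x \<in> \<Union>F"
      by (auto simp: F_def intro!: bexI[of _ "- C"])
  next
    fix x assume "x \<in> \<Union>F"
    then obtain U where "open U" "emeasure M U = 0" "x \<in> U"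
      by (auto simp: F_def)
    then show "x \<in> - supp M"
      by (auto simp: supp_def intro!: exI[of _ "- U"])
  qed
  moreover obtain F' where "F' \<subseteq> F" "countable F'" "\<Union>F' = \<Union>F"
    using Lindelof[of F] by (auto simp: F_def)
  moreover have "(\<Union>U\<in>F'. U) \<in> null_sets M"
    using \<open>F' \<subseteq> F\<close> assms by (intro null_sets_UN' \<open>countable F'\<close>) (auto simp: F_def null_sets_def)
  ultimately show ?thesis
    by auto
qed

lemma closed_supp: "closed (supp M)"
  by (auto simp: supp_def)

lemma AE_in_supp:
  fixes M :: "'a::second_countable_topology measure"
  assumes "sets M = sets borel"
  shows "AE x in M. x \<in> supp M"
  using emeasure_compl_supp[OF assms] closed_supp[of M] assms
  by (intro AE_I[of _ _ "- supp M"]) (auto simp: open_Compl borel_open)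

text \<open>Projection along a compact factor is a closed map. So the image of
  \<open>\<Gamma>\<close> is a closed set of full measure for the marginal, and the support lies in
  every such set.\<close>

lemma supp_distr_fst_subset:
  fixes \<pi> :: "('x::second_countable_topology \<times> 'y::second_countable_topology) measure"
  assumes "compact (UNIV :: 'y set)" "sets \<pi> = sets borel" "closed \<Gamma>" "AE z in \<pi>. z \<in> \<Gamma>"
  shows "supp (distr \<pi> borel fst) \<subseteq> fst ` \<Gamma>"
proof -
  have "closed_map (prod_topology euclidean euclidean) (euclidean :: 'x topology)
      (fst :: 'x \<times> 'y \<Rightarrow> 'x)"
    using assms(1) by (intro Abstract_Topological_Spaces.closed_map_fst) (simp add: compact_space_def)
  then have cl: "closed (fst ` \<Gamma>)"
    using assms(3) by (simp add: closed_map_def)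
  have meas: "fst \<in> measurable \<pi> borel"
    unfolding measurable_cong_sets[OF assms(2) refl]
    by (intro borel_measurable_continuous_onI continuous_intros)
  have "AE x in distr \<pi> borel fst. x \<in> fst ` \<Gamma>"
    using assms(4) cl by (subst AE_distr_iff[OF meas]) (auto elim!: eventually_mono)
  then have "emeasure (distr \<pi> borel fst) (- fst ` \<Gamma>) = 0"
    using cl by (subst (asm) AE_iff_measurable[of "- fst ` \<Gamma>"]) auto
  then show ?thesis
    using cl by (auto simp: supp_def)
qed

section \<open>Truncation and transfer of contact between plans of equal cost\<close>

text \<open>Clipping to \<open>[-n, n]\<close> is odd, monotone and 1-Lipschitz. From
  \<open>s \<le> d - t\<close>, clipped \<open>s\<close> is therefore at most \<open>d\<close> minus
  clipped \<open>t\<close>.\<close>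

lemma truncated_sum_le:
  fixes s t d n :: real
  assumes "0 \<le> n" "s + t \<le> d" "0 \<le> d"
  shows "max (- n) (min n s) + max (- n) (min n t) \<le> d"
  using assms by (auto simp: max_def min_def)

lemma truncated_sum_nonneg:
  fixes s t n :: real
  assumes "0 \<le> n" "0 \<le> s + t"
  shows "0 \<le> max (- n) (min n s) + max (- n) (min n t)"
  using assms by (auto simp: max_def min_def)

lemma tendsto_truncation:
  "(\<lambda>n. max (- real n) (min (real n) s)) \<longlonglongrightarrow> s"
proof (rule tendsto_eventually)
  obtain N :: nat where N: "\<bar>s\<bar> \<le> real N"
    using real_arch_simple by blast
  show "\<forall>\<^sub>F n in sequentially. max (- real n) (min (real n) s) = s"
    using eventually_ge_at_top[of N]
  proof eventually_elim
    case (elim n)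
    then have "real N \<le> real n" by simp
    with N show ?case by (auto simp: max_def min_def)
  qed
qed

lemma couplings_measurable:
  fixes \<pi> :: "('x::second_countable_topology \<times> 'y::second_countable_topology) measure"
  assumes "\<pi> \<in> couplings \<mu> \<nu>"
  shows "fst \<in> measurable \<pi> borel" "snd \<in> measurable \<pi> borel"
proof -
  have s: "sets \<pi> = sets borel"
    using assms by (auto simp: couplings_def borel_probs_def)
  show "fst \<in> measurable \<pi> borel" "snd \<in> measurable \<pi> borel"
    unfolding measurable_cong_sets[OF s refl]
    by (intro borel_measurable_continuous_onI continuous_intros)+
qed

text \<open>For bounded summands the integral is determined by the marginals, so it agrees for all
  couplings.\<close>

lemma couplings_integral_add:
  fixes \<pi> :: "('x::second_countable_topology \<times> 'y::second_countable_topology) measure"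
    and u :: "'x \<Rightarrow> real" and v :: "'y \<Rightarrow> real"
  assumes "\<pi> \<in> couplings \<mu> \<nu>"
    and [measurable]: "u \<in> borel_measurable borel" "v \<in> borel_measurable borel"
    and "\<And>x. \<bar>u x\<bar> \<le> B" "\<And>y. \<bar>v y\<bar> \<le> B"
  shows "integrable \<pi> (\<lambda>z. u (fst z) + v (snd z))"
    and "(\<integral>z. u (fst z) + v (snd z) \<partial>\<pi>) = integral\<^sup>L \<mu> u + integral\<^sup>L \<nu> v"
proof -
  interpret prob_space \<pi>
    using assms(1) by (auto simp: couplings_def borel_probs_def)
  note [measurable] = couplings_measurable[OF assms(1)]
  have "integrable \<pi> (\<lambda>z. u (fst z))" "integrable \<pi> (\<lambda>z. v (snd z))"
    using assms(4,5) by (auto intro!: integrable_const_bound[of _ B])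
  moreover have "(\<integral>z. u (fst z) \<partial>\<pi>) = integral\<^sup>L \<mu> u" "(\<integral>z. v (snd z) \<partial>\<pi>) = integral\<^sup>L \<nu> v"
    using assms(1) by (auto simp: couplings_def integral_distr[symmetric])
  ultimately show "integrable \<pi> (\<lambda>z. u (fst z) + v (snd z))"
    "(\<integral>z. u (fst z) + v (snd z) \<partial>\<pi>) = integral\<^sup>L \<mu> u + integral\<^sup>L \<nu> v"
    by auto
qed

text \<open>Potentials may fail to be integrable, so the integral of \<open>u + v\<close> cannot be computed from the
  marginals directly. Truncation makes both bounded; \<open>d n\<close> below has the same integral under both plans.\<close>

lemma contact_AE_transfer:
  fixes \<pi> \<pi>' :: "('x::second_countable_topology \<times> 'y::second_countable_topology) measure"
    and u :: "'x \<Rightarrow> real" and v :: "'y \<Rightarrow> real" and c :: "'x \<Rightarrow> 'y \<Rightarrow> real"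
  assumes \<pi>: "\<pi> \<in> couplings \<mu> \<nu>" and \<pi>': "\<pi>' \<in> couplings \<mu> \<nu>"
    and meas [measurable]: "u \<in> borel_measurable borel" "v \<in> borel_measurable borel"
    and C: "(\<lambda>(x, y). c x y) \<in> borel_measurable borel" and nonneg: "\<And>x y. c x y \<ge> 0"
    and cost: "plan_cost c \<pi>' = plan_cost c \<pi>" "plan_cost c \<pi> < \<infinity>"
    and eq: "AE (x, y) in \<pi>. u x + v y = c x y"
    and le: "AE (x, y) in \<pi>'. u x + v y \<le> c x y"
  shows "AE (x, y) in \<pi>'. u x + v y = c x y"
proof -
  define T where "T n s = max (- real n) (min (real n) s)" for n s
  define C where "C z = c (fst z) (snd z)" for z
  \<comment> \<open>The slack between cost and truncated sum. Its integral is the common cost minus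
    a quantity fixed by the marginals, hence the same under \<pi> and \<pi>'.\<close>
  define d where "d n z = C z - (T n (u (fst z)) + T n (v (snd z)))" for n z
  have sets: "sets \<pi> = sets borel" "sets \<pi>' = sets borel"
    using \<pi> \<pi>' by (auto simp: couplings_def borel_probs_def)
  note [measurable] = couplings_measurable[OF \<pi>] couplings_measurable[OF \<pi>']
  have Cm: "C \<in> borel_measurable borel"
    using C by (simp add: C_def[abs_def] case_prod_beta')
  have [measurable]: "C \<in> borel_measurable \<pi>" "C \<in> borel_measurable \<pi>'"
    unfolding measurable_cong_sets[OF sets(1) refl] measurable_cong_sets[OF sets(2) refl] by (rule Cm)+
  have pc: "plan_cost c p = (\<integral>\<^sup>+z. ennreal (C z) \<partial>p)" for p
    by (simp add: plan_cost_def C_def case_prod_beta')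
  have C0: "0 \<le> C z" for z
    using nonneg by (simp add: C_def)
  have Cint: "integrable \<pi> C" "integrable \<pi>' C"
    using cost C0 by (auto simp: integrable_iff_bounded pc)
  have Ceq: "integral\<^sup>L \<pi>' C = integral\<^sup>L \<pi> C"
    using cost C0 by (simp add: integral_eq_nn_integral pc)
  have Tm [measurable]: "T n \<in> borel_measurable borel" for n
    unfolding T_def by measurable
  have Tb: "\<bar>T n s\<bar> \<le> real n" for n s
    by (auto simp: T_def)
  note Tint = couplings_integral_add[of _ \<mu> \<nu> "\<lambda>x. T n (u x)" "\<lambda>y. T n (v y)" "real n" for n, OF _ _ _ Tb Tb]
  have dint: "integrable \<pi> (d n)" "integrable \<pi>' (d n)" for n
    unfolding d_def by (intro Bochner_Integration.integrable_diff Cint Tint(1) \<pi> \<pi>'; measurable)+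
  have deq: "integral\<^sup>L \<pi>' (d n) = integral\<^sup>L \<pi> (d n)" for n
    unfolding d_def
    by (subst (1 2) Bochner_Integration.integral_diff)
       (auto intro!: Cint Tint(1) \<pi> \<pi>' simp: Ceq Tint(2)[OF \<pi>] Tint(2)[OF \<pi>'])
  have dlim: "(\<lambda>n. d n z) \<longlonglongrightarrow> C z - (u (fst z) + v (snd z))" for z
    unfolding d_def T_def by (intro tendsto_intros tendsto_truncation)
  \<comment> \<open>Almost surely under \<pi>, \<open>u + v\<close> equals the nonnegative
    \<open>C\<close>, so the truncated sum lies between 0 and \<open>C\<close>; thus
    \<open>C\<close> dominates \<open>d n\<close>.\<close>
  have "(\<lambda>n. integral\<^sup>L \<pi> (d n)) \<longlonglongrightarrow> integral\<^sup>L \<pi> (\<lambda>z. 0)"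
  proof (rule integral_dominated_convergence)
    show "integrable \<pi> C" by (rule Cint)
    show "AE z in \<pi>. (\<lambda>n. d n z) \<longlonglongrightarrow> 0"
      using eq
    proof eventually_elim
      case (elim z)
      then show ?case using dlim[of z] by (simp add: C_def case_prod_beta')
    qed
    show "AE z in \<pi>. norm (d n z) \<le> C z" for n
      using eq
    proof eventually_elim
      case (elim z)
      then have "u (fst z) + v (snd z) = C z" by (simp add: C_def case_prod_beta')
      then show ?case
        using truncated_sum_le[of "real n" "u (fst z)" "v (snd z)" "C z"] C0[of z]
          truncated_sum_nonneg[of "real n" "u (fst z)" "v (snd z)"]
        by (simp add: d_def T_def)
    qed
  qed (use dint in \<open>auto simp: borel_measurable_integrable\<close>)
  then have lim0: "(\<lambda>n. ennreal (integral\<^sup>L \<pi>' (d n))) \<longlonglongrightarrow> 0"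
    using tendsto_ennrealI by (fastforce simp: deq)
  \<comment> \<open>Under \<pi>' only the inequality \<open>le\<close> is known, but it already
    makes the truncated slack nonnegative, as Fatou's lemma requires.\<close>
  have nn: "(\<integral>\<^sup>+z. ennreal (d n z) \<partial>\<pi>') = ennreal (integral\<^sup>L \<pi>' (d n))" for n
  proof (rule nn_integral_eq_integral[OF dint(2)])
    show "AE z in \<pi>'. 0 \<le> d n z"
      using le
    proof eventually_elim
      case (elim z)
      then show ?case
        using truncated_sum_le[of "real n" "u (fst z)" "v (snd z)" "C z"] C0[of z]
        by (simp add: d_def T_def C_def case_prod_beta')
    qed
  qed
  have [measurable]: "d n \<in> borel_measurable \<pi>'" for n
    using dint by auto
  \<comment> \<open>By Fatou's lemma the positive part of the limiting slack has integral 0 under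
    \<pi>'; together with \<open>le\<close> this forces equality.\<close>
  have "(\<integral>\<^sup>+z. ennreal (C z - (u (fst z) + v (snd z))) \<partial>\<pi>') = (\<integral>\<^sup>+z. liminf (\<lambda>n. ennreal (d n z)) \<partial>\<pi>')"
    by (intro nn_integral_cong lim_imp_Liminf[symmetric] tendsto_ennrealI dlim) simp
  also have "\<dots> \<le> liminf (\<lambda>n. \<integral>\<^sup>+z. ennreal (d n z) \<partial>\<pi>')"
    by (intro nn_integral_liminf) measurable
  also have "\<dots> = 0"
    unfolding nn using lim0 by (intro lim_imp_Liminf) auto
  finally have "AE z in \<pi>'. ennreal (C z - (u (fst z) + v (snd z))) = 0"
    by (subst (asm) le_zero_eq, subst (asm) nn_integral_0_iff_AE) auto
  then show ?thesis
    using le by eventually_elim (auto simp: C_def ennreal_eq_0_iff)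
qed

section \<open>Charts and regularity of c-concave functions\<close>

lemma is_chartD:
  assumes "is_chart (U, \<phi>)"
  shows "open U" "inj_on \<phi> U" "continuous_on U \<phi>"
    "\<And>V. open V \<Longrightarrow> V \<subseteq> U \<Longrightarrow> open (\<phi> ` V)"
proof -
  obtain \<psi> where h: "homeomorphism U (\<phi> ` U) \<phi> \<psi>" and o: "open U" "open (\<phi> ` U)"
    using assms by (auto simp: is_chart_def)
  then show "open U" "inj_on \<phi> U" "continuous_on U \<phi>"
    by (auto simp: homeomorphism_def intro: inj_on_inverseI)
  show "open (\<phi> ` V)" if "open V" "V \<subseteq> U" for V
    using homeomorphism_imp_open_map[OF h, of V] o that
    by (auto simp: openin_open_eq)
qed

lemma c_transform_Y_increment_le:
  assumes "\<And>y. c x y \<le> c x' y + d"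
  shows "c_transform_Y c g x \<le> c_transform_Y c g x' + ereal d"
proof -
  have "c_transform_Y c g x - ereal d \<le> c_transform_Y c g x'"
    unfolding c_transform_Y_def[of _ _ x']
  proof (rule INF_greatest)
    fix y
    have "c_transform_Y c g x \<le> ereal (c x y) - g y"
      unfolding c_transform_Y_def by (rule INF_lower) simp
    also have "\<dots> \<le> ereal (c x' y + d) - g y"
      using assms[of y] by (intro ereal_minus_mono) auto
    finally show "c_transform_Y c g x - ereal d \<le> ereal (c x' y) - g y"
      by (cases "g y"; cases "c_transform_Y c g x") auto
  qed
  then show ?thesis
    by (simp add: ereal_minus_le_iff add.commute)
qed

text \<open>At a point \<open>x0\<close> with finite value \<open>r\<close>, compactness bounds
  \<open>c x0\<close> by some \<open>K\<close>, so \<open>g\<close> is at most \<open>K - r\<close>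
  everywhere. As \<open>c\<close> is nonnegative, \<open>f\<close> is then at least
  \<open>r - K\<close> everywhere.\<close>

lemma c_concave_finite:
  fixes c :: "'x::topological_space \<Rightarrow> 'y::topological_space \<Rightarrow> real"
  assumes "compact (UNIV :: 'y set)" "\<And>x y. c x y \<ge> 0"
    "continuous_on UNIV (\<lambda>(x, y). c x y)" "c_concave c f"
  shows "\<bar>f x\<bar> \<noteq> \<infinity>"
proof -
  obtain g x0 where f: "f = c_transform_Y c g" "f x0 \<noteq> -\<infinity>" "\<And>x. f x \<noteq> \<infinity>"
    using assms(4) by (auto simp: c_concave_def)
  obtain r where r: "f x0 = ereal r"
    using f(2) f(3)[of x0] by (cases "f x0") auto
  have "continuous_on UNIV (\<lambda>y. c x0 y)"
    using continuous_on_compose2[OF assms(3) continuous_on_Pair[OF continuous_on_const continuous_on_id], of x0 UNIV]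
    by simp
  then obtain K where K: "\<And>y. c x0 y \<le> K"
    using compact_imp_bounded[OF compact_continuous_image[OF _ assms(1)], of "c x0"]
    by (fastforce simp: bounded_iff abs_le_iff)
  have "ereal (r - K) \<le> c_transform_Y c g x"
    unfolding c_transform_Y_def
  proof (rule INF_greatest)
    fix y
    have "ereal r \<le> ereal (c x0 y) - g y"
      unfolding r[symmetric] f(1) c_transform_Y_def by (rule INF_lower) simp
    then show "ereal (r - K) \<le> ereal (c x y) - g y"
      using K[of y] assms(2)[of x y] by (cases "g y") auto
  qed
  then show ?thesis
    using f(3)[of x] f(1) by (cases "f x") auto
qed

text \<open>This implication is what the arguments in charts use of c-concavity; they take it as an
  assumption on a real function. Being one-sided with a free \<open>d\<close>, it yields Lipschitz
  bounds in both directions.\<close>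

lemma c_concave_increment_le:
  assumes "c_concave c (\<lambda>x. ereal (F x))" "\<And>y. c x y \<le> c x' y + d"
  shows "F x \<le> F x' + d"
proof -
  obtain g where g: "(\<lambda>x. ereal (F x)) = c_transform_Y c g"
    using assms(1) by (auto simp: c_concave_def)
  have "ereal (F x) \<le> ereal (F x') + ereal d"
    using c_transform_Y_increment_le[of c, OF assms(2)] unfolding g[THEN fun_cong] .
  then show ?thesis
    by simp
qed

lemma chart_Lipschitz:
  assumes "\<And>y. L-lipschitz_on W (\<lambda>q. c (\<theta> q) y)"
    and "\<And>x x' d. (\<And>y. c x y \<le> c x' y + d) \<Longrightarrow> F x \<le> F x' + d"
  shows "L-lipschitz_on W (\<lambda>q. F (\<theta> q) :: real)"
proof (rule lipschitz_onI)
  show "0 \<le> L"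
    using assms(1) lipschitz_on_nonneg by blast
  fix p q assume "p \<in> W" "q \<in> W"
  then have "dist (c (\<theta> p) y) (c (\<theta> q) y) \<le> L * dist p q" for y
    using lipschitz_onD[OF assms(1)] by blast
  then have "c (\<theta> p) y \<le> c (\<theta> q) y + L * dist p q" "c (\<theta> q) y \<le> c (\<theta> p) y + L * dist p q" for y
    by (auto simp: dist_real_def abs_le_iff algebra_simps)
  then have "F (\<theta> p) \<le> F (\<theta> q) + L * dist p q" "F (\<theta> q) \<le> F (\<theta> p) + L * dist p q"
    using assms(2) by blast+
  then show "dist (F (\<theta> p)) (F (\<theta> q)) \<le> L * dist p q"
    by (auto simp: dist_real_def)
qed

lemma atlas_Lipschitz_chart:
  assumes "smooth_atlas A" "locally_Lipschitz_uniformly A (\<lambda>y x. c x y)"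
  obtains U \<phi> W L where "(U, \<phi>) \<in> A" "is_chart (U, \<phi>)" "x \<in> U" "open W" "\<phi> x \<in> W" "W \<subseteq> \<phi> ` U"
    "\<forall>y. L-lipschitz_on W (\<lambda>q. c (the_inv_into U \<phi> q) y)"
proof -
  obtain U \<phi> where C: "(U, \<phi>) \<in> A" "x \<in> U"
    using assms(1) unfolding smooth_atlas_def by force
  then have "is_chart (U, \<phi>)"
    using assms(1) by (auto simp: smooth_atlas_def)
  moreover have "\<forall>p\<in>\<phi> ` U. \<exists>W L. open W \<and> p \<in> W \<and> W \<subseteq> \<phi> ` U \<and>
      (\<forall>y. L-lipschitz_on W (\<lambda>q. c (the_inv_into U \<phi> q) y))"
    by (rule assms(2)[unfolded locally_Lipschitz_uniformly_def, THEN bspec, OF C(1), unfolded prod.case])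
  then obtain W L where "open W" "\<phi> x \<in> W" "W \<subseteq> \<phi> ` U"
      "\<forall>y. L-lipschitz_on W (\<lambda>q. c (the_inv_into U \<phi> q) y)"
    using C(2) by (meson imageI)
  ultimately show thesis
    using C that by metis
qed

lemma atlas_Lipschitz_continuous:
  fixes A :: "('x::t2_space, 'e::real_normed_vector) chart set"
  assumes "smooth_atlas A" "locally_Lipschitz_uniformly A (\<lambda>y x. c x y)"
    and F: "\<And>x x' d. (\<And>y. c x y \<le> c x' y + d) \<Longrightarrow> F x \<le> F x' + d"
  shows "continuous_on UNIV (F :: 'x \<Rightarrow> real)"
  unfolding continuous_on_eq_continuous_at[OF open_UNIV]
proof
  fix x
  obtain U \<phi> W L where C: "(U, \<phi>) \<in> A" "is_chart (U, \<phi>)" "x \<in> U" "open W" "\<phi> x \<in> W" "W \<subseteq> \<phi> ` U"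
    "\<forall>y. L-lipschitz_on W (\<lambda>q. c (the_inv_into U \<phi> q) y)"
    by (rule atlas_Lipschitz_chart[where x = x, OF assms(1,2)]) blast
  note D = is_chartD[OF C(2)]
  define V where "V = U \<inter> \<phi> -` W"
  have V: "open V" "x \<in> V"
    using C D by (auto simp: V_def intro!: continuous_open_preimage)
  have "continuous_on W (\<lambda>q. F (the_inv_into U \<phi> q))"
    by (rule lipschitz_on_continuous_on, rule chart_Lipschitz[where c = c, OF C(7)[rule_format]]) (rule F)
  then have "continuous_on V (\<lambda>x. F (the_inv_into U \<phi> (\<phi> x)))"
    by (rule continuous_on_compose2) (auto simp: V_def intro: continuous_on_subset[OF D(3)])
  then have "continuous_on V F"
    by (rule continuous_on_cong[THEN iffD1, rotated -1]) (auto simp: V_def the_inv_into_f_f[OF D(2)])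
  then show "isCont F x"
    using V by (simp add: continuous_on_eq_continuous_at)
qed

section \<open>Local constancy of the difference of two potentials\<close>

text \<open>Along a coordinate segment, the cost to the contact point \<open>y\<close> of a given
  point serves as \<open>k\<close> for both functions at that parameter. The one-dimensional
  comparison, applied in both orders, gives equal increments.\<close>

lemma common_contact_locally_constant_difference:
  fixes A :: "('x::topological_space, 'e::real_normed_vector) chart set"
    and F\<^sub>1 F\<^sub>2 :: "'x \<Rightarrow> real"
  assumes A: "smooth_atlas A"
    and diff: "\<And>y. manifold_differentiable A (\<lambda>x. c x y)"
    and lip: "locally_Lipschitz_uniformly A (\<lambda>y x. c x y)"
    and F\<^sub>1: "\<And>x x' d. (\<And>y. c x y \<le> c x' y + d) \<Longrightarrow> F\<^sub>1 x \<le> F\<^sub>1 x' + d"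
    and F\<^sub>2: "\<And>x x' d. (\<And>y. c x y \<le> c x' y + d) \<Longrightarrow> F\<^sub>2 x \<le> F\<^sub>2 x' + d"
    and M: "open M" "x \<in> M"
    and contact: "\<And>x. x \<in> M \<Longrightarrow>
      \<exists>y. \<forall>x'. F\<^sub>1 x' - F\<^sub>1 x \<le> c x' y - c x y \<and> F\<^sub>2 x' - F\<^sub>2 x \<le> c x' y - c x y"
  obtains T where "open T" "x \<in> T" "T \<subseteq> M" "\<forall>x'\<in>T. F\<^sub>1 x' - F\<^sub>2 x' = F\<^sub>1 x - F\<^sub>2 x"
proof -
  obtain U \<phi> W L where C: "(U, \<phi>) \<in> A" "is_chart (U, \<phi>)" "x \<in> U" "open W" "\<phi> x \<in> W" "W \<subseteq> \<phi> ` U"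
    "\<forall>y. L-lipschitz_on W (\<lambda>q. c (the_inv_into U \<phi> q) y)"
    by (rule atlas_Lipschitz_chart[where x = x, OF A lip]) blast
  note D = is_chartD[OF C(2)]
  define \<theta> where "\<theta> = the_inv_into U \<phi>"
  have \<theta>: "\<theta> (\<phi> z) = z" if "z \<in> U" for z
    using that D(2) by (simp add: \<theta>_def the_inv_into_f_f)
  have "open (W \<inter> \<phi> ` (M \<inter> U))"
    using C(4) D(1) M(1) by (intro open_Int D(4)) auto
  moreover have "\<phi> x \<in> W \<inter> \<phi> ` (M \<inter> U)"
    using C M by auto
  \<comment> \<open>A coordinate ball contains the segments from its centre to its points.
    Membership in \<open>W\<close> gives the Lipschitz bound, and \<open>M\<close> supplies contact
    points.\<close>
  ultimately obtain r where r: "0 < r" "ball (\<phi> x) r \<subseteq> W \<inter> \<phi> ` (M \<inter> U)"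
    by (meson openE)
  have \<theta>M: "\<theta> q \<in> M" if "q \<in> ball (\<phi> x) r" for q
    using r(2) that \<theta> by fastforce
  have lips: "L-lipschitz_on W (\<lambda>q. F\<^sub>1 (\<theta> q))" "L-lipschitz_on W (\<lambda>q. F\<^sub>2 (\<theta> q))"
    unfolding \<theta>_def by (rule chart_Lipschitz[where c = c, OF C(7)[rule_format]]; rule F\<^sub>1 F\<^sub>2; assumption)+
  have L0: "0 \<le> L"
    using C(7) lipschitz_on_nonneg by blast
  define T where "T = U \<inter> \<phi> -` ball (\<phi> x) r"
  show thesis
  proof (rule that[of T])
    show "open T"
      using D by (auto simp: T_def intro!: continuous_open_preimage)
    show "x \<in> T"
      using C r by (auto simp: T_def)
    show "T \<subseteq> M"
      using \<theta> \<theta>M by (fastforce simp: T_def)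
    show "\<forall>x'\<in>T. F\<^sub>1 x' - F\<^sub>2 x' = F\<^sub>1 x - F\<^sub>2 x"
    proof
      fix x' assume x': "x' \<in> T"
      define \<rho> where "\<rho> = dist (\<phi> x) (\<phi> x')"
      \<comment> \<open>The extended segment must stay in the ball:
        \<open>(1 + \<eta>) * \<rho> < r\<close> amounts to
        \<open>\<eta> * \<rho> < r - \<rho>\<close>, which holds since
        \<open>\<rho> < r\<close>.\<close>
      define \<eta> where "\<eta> = (r - \<rho>) / r"
      define \<gamma> where "\<gamma> t = \<phi> x + t *\<^sub>R (\<phi> x' - \<phi> x)" for t
      have \<rho>: "0 \<le> \<rho>" "\<rho> < r"
        using x' by (auto simp: T_def \<rho>_def)
      have "(r - \<rho>) * \<rho> < (r - \<rho>) * r"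
        using \<rho> by (intro mult_strict_left_mono) auto
      then have \<eta>: "0 < \<eta>" "(1 + \<eta>) * \<rho> < r"
        using \<rho> r(1) by (auto simp: \<eta>_def field_simps)
      have \<gamma>: "\<gamma> t \<in> ball (\<phi> x) r" if "t \<in> {0 - \<eta>..1 + \<eta>}" for t
      proof -
        have "dist (\<phi> x) (\<gamma> t) = \<bar>t\<bar> * \<rho>"
          by (simp add: \<gamma>_def \<rho>_def dist_norm norm_minus_commute)
        also have "\<dots> \<le> (1 + \<eta>) * \<rho>"
          using that \<rho> \<eta> by (intro mult_right_mono) auto
        finally show ?thesis
          using \<eta> by simp
      qed
      \<comment> \<open>The factor \<open>\<rho>\<close> is the constant speed of
        \<open>\<gamma>\<close>.\<close>
      have lip\<gamma>: "(L * \<rho>)-lipschitz_on {0 - \<eta>..1 + \<eta>} (\<lambda>t. F (\<theta> (\<gamma> t)))"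
        if "L-lipschitz_on W (\<lambda>q. F (\<theta> q))" for F :: "'x \<Rightarrow> real"
      proof (rule lipschitz_onI)
        show "0 \<le> L * \<rho>" using L0 \<rho> by simp
        fix s t assume st: "s \<in> {0 - \<eta>..1 + \<eta>}" "t \<in> {0 - \<eta>..1 + \<eta>}"
        have "\<gamma> s - \<gamma> t = (s - t) *\<^sub>R (\<phi> x' - \<phi> x)"
          by (simp add: \<gamma>_def algebra_simps)
        then have "dist (\<gamma> s) (\<gamma> t) = \<rho> * dist s t"
          by (simp add: dist_norm \<rho>_def norm_minus_commute mult.commute)
        then show "dist (F (\<theta> (\<gamma> s))) (F (\<theta> (\<gamma> t))) \<le> L * \<rho> * dist s t"
          using lipschitz_onD[OF that, of "\<gamma> s" "\<gamma> t"] \<gamma>[OF st(1)] \<gamma>[OF st(2)] r(2)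
          by (auto simp: mult.assoc subset_iff)
      qed
      have super: "\<exists>k D. (k has_real_derivative D) (at t) \<and>
          (\<forall>s. F\<^sub>1 (\<theta> (\<gamma> s)) - F\<^sub>1 (\<theta> (\<gamma> t)) \<le> k s - k t \<and>
               F\<^sub>2 (\<theta> (\<gamma> s)) - F\<^sub>2 (\<theta> (\<gamma> t)) \<le> k s - k t)"
        if t: "t \<in> {0..1}" for t
      proof -
        have \<gamma>t: "\<gamma> t \<in> ball (\<phi> x) r"
          using t \<eta> by (intro \<gamma>) auto
        then obtain y where y: "\<forall>x'. F\<^sub>1 x' - F\<^sub>1 (\<theta> (\<gamma> t)) \<le> c x' y - c (\<theta> (\<gamma> t)) y \<and>
            F\<^sub>2 x' - F\<^sub>2 (\<theta> (\<gamma> t)) \<le> c x' y - c (\<theta> (\<gamma> t)) y"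
          using contact[OF \<theta>M] by blast
        have "\<gamma> t \<in> \<phi> ` U"
          using \<gamma>t r(2) by auto
        then have "(\<lambda>q. c (\<theta> q) y) differentiable (at (\<gamma> t))"
          unfolding \<theta>_def
          by (rule diff[of y, unfolded manifold_differentiable_def, THEN bspec, OF C(1), unfolded prod.case, THEN bspec])
        moreover have "\<gamma> differentiable (at t)"
          unfolding \<gamma>_def by (auto intro!: derivative_intros)
        ultimately have "((\<lambda>q. c (\<theta> q) y) \<circ> \<gamma>) differentiable (at t)"
          by (intro differentiable_chain_at)
        then obtain D where "((\<lambda>s. c (\<theta> (\<gamma> s)) y) has_real_derivative D) (at t)"
          by (auto simp: real_differentiable_def o_def)
        with y show ?thesis by blast
      qed
      have "F\<^sub>1 (\<theta> (\<gamma> 1)) - F\<^sub>1 (\<theta> (\<gamma> 0)) \<le> F\<^sub>2 (\<theta> (\<gamma> 1)) - F\<^sub>2 (\<theta> (\<gamma> 0))"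
        by (rule common_superderivative_increment_le[OF _ \<eta>(1) lip\<gamma>[OF lips(1)] lip\<gamma>[OF lips(2)]])
          (simp, use super in blast)
      moreover have "F\<^sub>2 (\<theta> (\<gamma> 1)) - F\<^sub>2 (\<theta> (\<gamma> 0)) \<le> F\<^sub>1 (\<theta> (\<gamma> 1)) - F\<^sub>1 (\<theta> (\<gamma> 0))"
        by (rule common_superderivative_increment_le[OF _ \<eta>(1) lip\<gamma>[OF lips(2)] lip\<gamma>[OF lips(1)]])
          (simp, use super in blast)
      moreover have "\<theta> (\<gamma> 1) = x'" "\<theta> (\<gamma> 0) = x"
        using x' C(3) by (auto simp: \<gamma>_def T_def \<theta>)
      ultimately show "F\<^sub>1 x' - F\<^sub>2 x' = F\<^sub>1 x - F\<^sub>2 x"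
        by simp
    qed
  qed
qed

section \<open>Almost sure contact of a potential with the cost\<close>

text \<open>The positive part of \<open>h\<close> has integral at most that of \<open>k\<close>, so
  equality of the finite integrals forces the negative part to integrate to 0 and the positive part
  to agree with \<open>k\<close> almost everywhere.\<close>

lemma ereal_integral_eq_imp_AE_eq:
  fixes k :: "'a \<Rightarrow> real" and h :: "'a \<Rightarrow> ereal"
  assumes [measurable]: "h \<in> borel_measurable M" "k \<in> borel_measurable M"
    and le: "\<And>z. h z \<le> ereal (k z)" and k: "\<And>z. 0 \<le> k z"
    and fin: "(\<integral>\<^sup>+z. ennreal (k z) \<partial>M) < \<infinity>"
    and eq: "enn2ereal (\<integral>\<^sup>+z. ennreal (k z) \<partial>M) = ereal_integral M h"
  shows "AE z in M. h z = ereal (k z)"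
proof -
  have le': "e2ennreal (h z) \<le> ennreal (k z)" for z
    using e2ennreal_mono[OF le[of z]] by simp
  let ?P = "\<integral>\<^sup>+z. e2ennreal (h z) \<partial>M" and ?N = "\<integral>\<^sup>+z. e2ennreal (- h z) \<partial>M"
    and ?T = "\<integral>\<^sup>+z. ennreal (k z) \<partial>M"
  have PT: "?P \<le> ?T"
    by (intro nn_integral_mono le')
  have "enn2ereal ?T = enn2ereal ?P - enn2ereal ?N"
    using eq by (simp add: ereal_integral_def)
  moreover obtain t where t: "0 \<le> t" "?T = ennreal t"
    using fin by (cases ?T) auto
  moreover obtain p where p: "0 \<le> p" "?P = ennreal p"
    using PT fin by (cases ?P) (auto simp: top_unique)
  ultimately have *: "ereal t = ereal p - enn2ereal ?N"
    by (simp add: enn2ereal_ennreal)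
  \<comment> \<open>An infinite negative part would make the right-hand side
    \<open>-\<infinity>\<close>.\<close>
  then obtain n where n: "0 \<le> n" "?N = ennreal n"
    by (cases ?N) (auto simp: enn2ereal_top)
  with * have "t = p - n"
    by (simp add: enn2ereal_ennreal)
  then have P: "?P = ?T" and N: "?N = 0"
    using PT t p n by (auto simp: ennreal_le_iff)
  have "(\<integral>\<^sup>+z. ennreal (k z) - e2ennreal (h z) \<partial>M) = ?T - ?P"
    using PT fin by (intro nn_integral_diff) (auto intro!: le')
  then have "(\<integral>\<^sup>+z. ennreal (k z) - e2ennreal (h z) \<partial>M) = 0"
    using P fin by simp
  then have "AE z in M. ennreal (k z) - e2ennreal (h z) = 0"
    by (subst (asm) nn_integral_0_iff_AE) auto
  moreover have "AE z in M. e2ennreal (- h z) = 0"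
    using N by (subst (asm) nn_integral_0_iff_AE) auto
  ultimately show ?thesis
  proof eventually_elim
    case (elim z)
    have "\<bar>h z\<bar> \<noteq> \<infinity>" using elim le[of z] by (cases "h z") (auto simp: e2ennreal_infty)
    then obtain s where s: "h z = ereal s" by auto
    with elim(1) le'[of z] have "ennreal (k z) \<le> ennreal s"
      by (simp add: e2ennreal_ereal diff_eq_0_iff_ennreal)
    moreover have "0 \<le> s" using elim(2) s by (simp add: e2ennreal_ereal ennreal_eq_0_iff)
    ultimately show ?case using le[of z] s k[of z] by (auto simp: ennreal_le_iff)
  qed
qed

text \<open>The infimum may range over uncountably many \<open>x\<close>, but it is upper
  semicontinuous: its strict sublevel sets are unions of open sets.\<close>

lemma c_transform_X_measurable:
  fixes c :: "'x::topological_space \<Rightarrow> 'y::topological_space \<Rightarrow> real"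
  assumes "\<And>x. continuous_on UNIV (c x)"
  shows "c_transform_X c (\<lambda>x. ereal (F x)) \<in> borel_measurable borel"
proof (rule borel_measurableI_less)
  fix a :: ereal
  have "open {y. ereal (c x y - F x) < a}" for x
    using assms[of x] by (intro open_Collect_less continuous_intros) auto
  then have "open (\<Union>x. {y. ereal (c x y - F x) < a})"
    by blast
  also have "(\<Union>x. {y. ereal (c x y - F x) < a}) = {y \<in> space borel. c_transform_X c (\<lambda>x. ereal (F x)) y < a}"
    by (auto simp: c_transform_X_def INF_less_iff)
  finally show "{y \<in> space borel. c_transform_X c (\<lambda>x. ereal (F x)) y < a} \<in> sets borel"
    by (rule borel_open)
qed

lemma c_transform_X_le:
  "c_transform_X c (\<lambda>x. ereal (F x)) y \<le> ereal (c x y - F x)"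
  unfolding c_transform_X_def by (rule INF_lower2[of x]) auto

lemma c_transform_X_add_le:
  "ereal (F x) + c_transform_X c (\<lambda>x. ereal (F x)) y \<le> ereal (c x y)"
  using c_transform_X_le[of c F y x] by (cases "c_transform_X c (\<lambda>x. ereal (F x)) y") auto

text \<open>Comparing the contact equality at \<open>x\<close> with the inequality at
  \<open>x'\<close> eliminates the transform.\<close>

lemma contact_increment_le:
  assumes "ereal (F x) + c_transform_X c (\<lambda>x. ereal (F x)) y = ereal (c x y)"
  shows "F x' - F x \<le> c x' y - c x y"
  using assms c_transform_X_le[of c F y x'] by (cases "c_transform_X c (\<lambda>x. ereal (F x)) y") auto

text \<open>A potential satisfies its integral identity for some optimal plan of its own. Comparing
  two potentials requires contact under one common plan, hence the passage to an arbitrary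
  \<pi>'.\<close>

lemma potential_contact_AE:
  fixes c :: "'x::second_countable_topology \<Rightarrow> 'y::second_countable_topology \<Rightarrow> real"
  assumes cont: "continuous_on UNIV (\<lambda>(x, y). c x y)" and nonneg: "\<And>x y. c x y \<ge> 0"
    and T: "transport_cost c \<mu> \<nu> < \<infinity>"
    and F: "continuous_on UNIV F"
    and f: "(\<lambda>x. ereal (F x)) \<in> Kantorovich_potentials c \<mu> \<nu>"
    and \<pi>': "\<pi>' \<in> optimal_plans c \<mu> \<nu>"
  shows "AE (x, y) in \<pi>'. ereal (F x) + c_transform_X c (\<lambda>x. ereal (F x)) y = ereal (c x y)"
proof -
  define G where "G = c_transform_X c (\<lambda>x. ereal (F x))"
  obtain \<pi> where \<pi>: "\<pi> \<in> optimal_plans c \<mu> \<nu>"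
    and int: "enn2ereal (transport_cost c \<mu> \<nu>) = ereal_integral \<pi> (\<lambda>(x, y). ereal (F x) + G y)"
    using f by (auto simp: Kantorovich_potentials_def G_def)
  have cpl: "\<pi> \<in> couplings \<mu> \<nu>" "\<pi>' \<in> couplings \<mu> \<nu>"
    and cost: "plan_cost c \<pi> = transport_cost c \<mu> \<nu>" "plan_cost c \<pi>' = transport_cost c \<mu> \<nu>"
    using \<pi> \<pi>' by (auto simp: optimal_plans_def)
  note [measurable] = couplings_measurable[OF cpl(1)] couplings_measurable[OF cpl(2)]
  have "continuous_on UNIV (c x)" for x
    using continuous_on_compose2[OF cont continuous_on_Pair[OF continuous_on_const continuous_on_id], of x UNIV]
    by simp
  then have [measurable]: "G \<in> borel_measurable borel"
    unfolding G_def by (rule c_transform_X_measurable)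
  have [measurable]: "F \<in> borel_measurable borel"
    using F by (rule borel_measurable_continuous_onI)
  have cm: "(\<lambda>(x, y). c x y) \<in> borel_measurable borel"
    using cont by (rule borel_measurable_continuous_onI)
  have sets: "sets \<pi> = sets borel"
    using cpl by (auto simp: couplings_def borel_probs_def)
  have AE\<pi>: "AE z in \<pi>. (case z of (x, y) \<Rightarrow> ereal (F x) + G y) = ereal (case z of (x, y) \<Rightarrow> c x y)"
  proof (rule ereal_integral_eq_imp_AE_eq)
    show "(\<lambda>(x, y). ereal (F x) + G y) \<in> borel_measurable \<pi>"
      unfolding case_prod_beta' by measurable
    show "(\<lambda>(x, y). c x y) \<in> borel_measurable \<pi>"
      unfolding measurable_cong_sets[OF sets refl] by (rule cm)
    show "(case z of (x, y) \<Rightarrow> ereal (F x) + G y) \<le> ereal (case z of (x, y) \<Rightarrow> c x y)" for z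
      by (auto simp: G_def c_transform_X_add_le split: prod.split)
    show "0 \<le> (case z of (x, y) \<Rightarrow> c x y)" for z
      using nonneg by (auto split: prod.split)
    have "(\<integral>\<^sup>+z. ennreal (case z of (x, y) \<Rightarrow> c x y) \<partial>\<pi>) = transport_cost c \<mu> \<nu>"
      using cost(1) by (simp add: plan_cost_def case_prod_beta')
    then show "(\<integral>\<^sup>+z. ennreal (case z of (x, y) \<Rightarrow> c x y) \<partial>\<pi>) < \<infinity>"
      "enn2ereal (\<integral>\<^sup>+z. ennreal (case z of (x, y) \<Rightarrow> c x y) \<partial>\<pi>) =
        ereal_integral \<pi> (\<lambda>(x, y). ereal (F x) + G y)"
      using T int by simp_all
  qed
  \<comment> \<open>\<open>G\<close> may take the value \<open>-\<infinity>\<close>, which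
    \<open>real_of_ereal\<close> would send to 0. Finiteness almost everywhere concerns the second
    marginal alone, so it passes from \<pi> to \<pi>'.\<close>
  have "AE z in \<pi>. \<bar>G (snd z)\<bar> \<noteq> \<infinity>"
    using AE\<pi> by eventually_elim (auto split: prod.splits)
  then have "AE y in distr \<pi> borel snd. \<bar>G y\<bar> \<noteq> \<infinity>"
    by (subst AE_distr_iff) auto
  also have "distr \<pi> borel snd = distr \<pi>' borel snd"
    using cpl by (simp add: couplings_def)
  finally have Gfin: "AE z in \<pi>'. \<bar>G (snd z)\<bar> \<noteq> \<infinity>"
    by (subst (asm) AE_distr_iff) auto
  have "AE (x, y) in \<pi>'. F x + real_of_ereal (G y) = c x y"
  proof (rule contact_AE_transfer[OF cpl _ _ cm nonneg])
    show "AE (x, y) in \<pi>. F x + real_of_ereal (G y) = c x y"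
      using AE\<pi>
    proof eventually_elim
      case (elim z)
      then show ?case by (cases z; cases "G (snd z)") auto
    qed
    show "AE (x, y) in \<pi>'. F x + real_of_ereal (G y) \<le> c x y"
      using Gfin
    proof eventually_elim
      case (elim z)
      then show ?case
        using c_transform_X_add_le[of F "fst z" c "snd z"]
        by (cases z; cases "G (snd z)") (auto simp: G_def)
    qed
  qed (use cost T in auto)
  then show ?thesis
    unfolding G_def[symmetric] using Gfin
  proof eventually_elim
    case (elim z)
    then show ?case by (cases z; cases "G (snd z)") auto
  qed
qed

section \<open>Uniqueness of the potentials\<close>

theorem corollary2:
  fixes A :: "('x::polish_space, 'e::real_normed_vector) chart set"
    and \<mu> :: "'x measure" and \<nu> :: "'y::polish_space measure"
    and c :: "'x \<Rightarrow> 'y \<Rightarrow> real"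
  assumes "smooth_atlas A"
    and "compact (UNIV :: 'y set)"
    and "\<mu> \<in> borel_probs" and "\<nu> \<in> borel_probs"
    and "\<And>x y. c x y \<ge> 0"
    and "continuous_on UNIV (\<lambda>(x, y). c x y)"
    and "\<And>y. manifold_differentiable A (\<lambda>x. c x y)"
    and "locally_Lipschitz_uniformly A (\<lambda>y x. c x y)"
    and "transport_cost c \<mu> \<nu> < \<infinity>"
    and "connected (interior (supp \<mu>))"
    and "closure (interior (supp \<mu>)) = supp \<mu>"
  shows "unique_Kantorovich_potentials c \<mu> \<nu>"
  unfolding unique_Kantorovich_potentials_def
proof (intro ballI)
  fix f\<^sub>1 f\<^sub>2
  assume f: "f\<^sub>1 \<in> Kantorovich_potentials c \<mu> \<nu>" "f\<^sub>2 \<in> Kantorovich_potentials c \<mu> \<nu>"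
  define F\<^sub>1 F\<^sub>2 where "F\<^sub>1 x = real_of_ereal (f\<^sub>1 x)" and "F\<^sub>2 x = real_of_ereal (f\<^sub>2 x)" for x
  have conc: "c_concave c f\<^sub>1" "c_concave c f\<^sub>2"
    using f by (auto simp: Kantorovich_potentials_def)
  have eq: "f\<^sub>1 = (\<lambda>x. ereal (F\<^sub>1 x))" "f\<^sub>2 = (\<lambda>x. ereal (F\<^sub>2 x))"
    using c_concave_finite[OF assms(2,5,6) conc(1)] c_concave_finite[OF assms(2,5,6) conc(2)]
    by (simp_all add: F\<^sub>1_def F\<^sub>2_def ereal_real)
  note incr = c_concave_increment_le[OF conc(1)[unfolded eq(1)]] c_concave_increment_le[OF conc(2)[unfolded eq(2)]]
  have cont: "continuous_on UNIV F\<^sub>1" "continuous_on UNIV F\<^sub>2"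
    by (rule atlas_Lipschitz_continuous[OF assms(1,8)]; rule incr; assumption)+
  \<comment> \<open>Membership of a potential already provides an optimal plan.\<close>
  obtain \<pi> where \<pi>: "\<pi> \<in> optimal_plans c \<mu> \<nu>"
    using f by (auto simp: Kantorovich_potentials_def)
  then have marginal: "distr \<pi> borel fst = \<mu>" "sets \<pi> = sets borel"
    by (auto simp: optimal_plans_def couplings_def borel_probs_def)
  \<comment> \<open>A closed set: it involves \<open>F\<^sub>1\<close> and \<open>F\<^sub>2\<close> only, not their merely upper semicontinuous transforms.\<close>
  define \<Gamma> where "\<Gamma> = {z. \<forall>x'. F\<^sub>1 x' - F\<^sub>1 (fst z) \<le> c x' (snd z) - c (fst z) (snd z) \<and>
    F\<^sub>2 x' - F\<^sub>2 (fst z) \<le> c x' (snd z) - c (fst z) (snd z)}"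
  have contact: "AE (x, y) in \<pi>. ereal (F x) + c_transform_X c (\<lambda>x. ereal (F x)) y = ereal (c x y)"
    if "continuous_on UNIV F" "(\<lambda>x. ereal (F x)) \<in> Kantorovich_potentials c \<mu> \<nu>" for F
    using assms(6,5,9) that \<pi> by (rule potential_contact_AE)
  have "AE z in \<pi>. z \<in> \<Gamma>"
    using contact[OF cont(1) f(1)[unfolded eq(1)]] contact[OF cont(2) f(2)[unfolded eq(2)]]
    by eventually_elim (auto simp: \<Gamma>_def intro: contact_increment_le split: prod.splits)
  moreover have "closed \<Gamma>"
  proof -
    have "continuous_on UNIV (\<lambda>z. c (fst z) (snd z))"
      using assms(6) by (simp add: case_prod_beta')
    moreover have "continuous_on UNIV (\<lambda>z::'x \<times> 'y. c x' (snd z))" for x'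
      using continuous_on_compose2[OF assms(6) continuous_on_Pair[OF continuous_on_const[of _ x'] continuous_on_snd[OF continuous_on_id]]]
      by simp
    moreover have "continuous_on UNIV (\<lambda>z::'x \<times> 'y. F\<^sub>1 (fst z))" "continuous_on UNIV (\<lambda>z::'x \<times> 'y. F\<^sub>2 (fst z))"
      using continuous_on_compose2[OF cont(1) continuous_on_fst[OF continuous_on_id]]
        continuous_on_compose2[OF cont(2) continuous_on_fst[OF continuous_on_id]] by auto
    ultimately show ?thesis
      unfolding \<Gamma>_def by (intro closed_Collect_all closed_Collect_conj closed_Collect_le continuous_intros)
  qed
  \<comment> \<open>This upgrades almost sure contact to a contact point for every \<open>x\<close>
    in the support, as needed along whole segments.\<close>
  ultimately have "supp \<mu> \<subseteq> fst ` \<Gamma>"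
    using supp_distr_fst_subset[OF assms(2) marginal(2)] marginal(1) by auto
  then have common: "\<exists>y. \<forall>x'. F\<^sub>1 x' - F\<^sub>1 x \<le> c x' y - c x y \<and> F\<^sub>2 x' - F\<^sub>2 x \<le> c x' y - c x y"
    if "x \<in> interior (supp \<mu>)" for x
    using that interior_subset by (fastforce simp: \<Gamma>_def)
  have "(\<lambda>x. F\<^sub>1 x - F\<^sub>2 x) constant_on interior (supp \<mu>)"
  proof (rule locally_constant_imp_constant[OF assms(10)])
    fix x assume x: "x \<in> interior (supp \<mu>)"
    obtain T where "open T" "x \<in> T" "T \<subseteq> interior (supp \<mu>)"
      "\<forall>x'\<in>T. F\<^sub>1 x' - F\<^sub>2 x' = F\<^sub>1 x - F\<^sub>2 x"
      by (rule common_contact_locally_constant_difference[OF assms(1,7,8) incr open_interior x common]) blast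
    moreover from this have "openin (top_of_set (interior (supp \<mu>))) T"
      by (intro open_subset)
    ultimately show "\<exists>T. openin (top_of_set (interior (supp \<mu>))) T \<and> x \<in> T \<and>
        (\<forall>x'\<in>T. F\<^sub>1 x' - F\<^sub>2 x' = F\<^sub>1 x - F\<^sub>2 x)"
      by blast
  qed
  \<comment> \<open>The boundary of the support may carry mass; continuity of
    \<open>F\<^sub>1\<close> and \<open>F\<^sub>2\<close> extends the constant to it.\<close>
  then have "(\<lambda>x. F\<^sub>1 x - F\<^sub>2 x) constant_on closure (interior (supp \<mu>))"
    by (rule constant_on_closureI)
      (intro continuous_on_diff continuous_on_subset[OF cont(1)] continuous_on_subset[OF cont(2)] subset_UNIV)
  then obtain a where "\<And>x. x \<in> supp \<mu> \<Longrightarrow> F\<^sub>1 x - F\<^sub>2 x = a"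
    unfolding assms(11) constant_on_def by blast
  moreover have "AE x in \<mu>. x \<in> supp \<mu>"
    using assms(3) by (intro AE_in_supp) (simp add: borel_probs_def)
  ultimately have "AE x in \<mu>. f\<^sub>1 x - f\<^sub>2 x = ereal a"
    by (auto simp: eq elim!: eventually_mono)
  then show "\<exists>a::real. AE x in \<mu>. f\<^sub>1 x - f\<^sub>2 x = ereal a" ..
qed

end
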